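(* Let $(\bar u,\bar\mu)\in\mathcal D$, and let $(u,\mu)$ be the conservative solution, subject to the initial data $(\bar u,\bar\mu)$, of the generalized framework $$u_t+uu_x=\tfrac14\left(\int_{-\infty}^x-\int_x^{+\infty}\right)d\mu(t),\qquad \mu_t+(u\mu)_x=0,\qquad d\mu_{ac}(t)=u_x^2(\cdot,t)\,dx$$ of the Hunter–Saxton equation $u_t+uu_x=\frac14\left(\int_{-\infty}^x u_y^2(y,t)\,dy-\int_x^{+\infty}u_y^2(y,t)\,dy\right)$. Then for any fixed $x\in\mathbb R$, $$\lim_{t\to+\infty}u(x,t)=-\bar u(\bar x(\alpha^* )),$$ where $\alpha^*$ is any real number such that $\alpha^*-\bar x(\alpha^* )=\frac12\bar\mu(\mathbb R)$.
   Context: Notation. $C_b(\mathbb R)$ is the space of bounded continuous functions on $\mathbb R$ with the sup-norm; $\mathcal M_+(\mathbb R)$ is the set of finite nonnegative Radon measures on $\mathbb R$ endowed with the weak topology. The space $\mathcal D$ is the set of all pairs $(u,\mu)$ such that (i) $u\in C_b(\mathbb R)$ and $u_x\in L^2(\mathbb R)$; (ii) $\mu\in\mathcal M_+(\mathbb R)$; (iii) $d\mu_{ac}=u_x^2\,dx$, where $\mu_{ac}$ is the absolutely continuous part of $\mu$ with respect to Lebesgue measure $dx$. The function $\bar x$. For $(\bar u,\bar\mu)\in\mathcal D$ and $\alpha\in\mathbb R$, $\bar x(\alpha)$ is the real number determined by $$\bar x(\alpha)+\bar\mu((-\infty,\bar x(\alpha)))\le\alpha\le\bar x(\alpha)+\bar\mu((-\infty,\bar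 x(\alpha)]).$$ It is a nondecreasing, Lipschitz continuous function of $\alpha$ with Lipschitz constant at most $1$. Conservative solution of this framework. Set, for $\alpha,t\in\mathbb R$, $$y(\alpha,t):=\bar x(\alpha)+\bar u(\bar x(\alpha))t+\frac{t^2}{4}\left[\alpha-\bar x(\alpha)-\tfrac12\bar\mu(\mathbb R)\right].$$ The unique global-in-time conservative solution $(u,\mu)$ with initial data $(\bar u,\bar\mu)$ is given by $$u(x,t)=\bar u(\bar x(\alpha))+\frac t2\left[\alpha-\bar x(\alpha)-\tfrac12\bar\mu(\mathbb R)\right]\ \text{ for } x=y(\alpha,t),\qquad \mu(t)=y(\cdot,t)\#\big(f\,d\alpha\big),\quad f(\alpha):=1-\bar x'(\alpha)$$ ($\#$ denotes push-forward of measures; for each $t$ the map $\alpha\mapsto y(\alpha,t)$ is onto $\mathbb R$, and the value $u(x,t)$ does not depend on the choice of $\alpha$ with $y(\alpha,t)=x$).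
   Formalization: The formal theorem assumes that the total mass of the initial measure is nonzero or the initial velocity is identically zero; for zero measure and constant velocity c ≠ 0 the solution is u = c, so the stated limit −c is false. *)

theory Defs
  imports "HOL-Analysis.Analysis"
begin

text \<open>The space \<open>C\<^sub>c\<^sup>\<infinity>\<close> of test functions on the real line.\<close>

definition test_fun :: "(real \<Rightarrow> real) \<Rightarrow> bool" where
  "test_fun \<phi> \<longleftrightarrow>
     (\<forall>k x. (deriv ^^ k) \<phi> differentiable (at x)) \<and> compact (closure {x. \<phi> x \<noteq> 0})"

text \<open>\<open>v\<close> is the distributional derivative of the locally integrable function \<open>u\<close>.\<close>

definition has_weak_deriv :: "(real \<Rightarrow> real) \<Rightarrow> (real \<Rightarrow> real) \<Rightarrow> bool" where
  "has_weak_deriv u v \<longleftrightarrow>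
     (\<forall>a b. set_integrable lborel {a..b} u) \<and>
     (\<forall>a b. set_integrable lborel {a..b} v) \<and>
     (\<forall>\<phi>. test_fun \<phi> \<longrightarrow> (LINT x|lborel. u x * deriv \<phi> x) = - (LINT x|lborel. v x * \<phi> x))"

definition mutually_singular :: "'a measure \<Rightarrow> 'a measure \<Rightarrow> bool" where
  "mutually_singular N S \<longleftrightarrow>
     sets S = sets N \<and> (\<exists>Z \<in> null_sets N. space N - Z \<in> null_sets S)"

text \<open>\<open>A\<close> is the absolutely continuous part of \<open>M\<close> in its Lebesgue decomposition
  with respect to \<open>N\<close>.\<close>

definition is_ac_part :: "'a measure \<Rightarrow> 'a measure \<Rightarrow> 'a measure \<Rightarrow> bool" where
  "is_ac_part N M A \<longleftrightarrow>
     sets M = sets N \<and> sets A = sets N \<and> absolutely_continuous N A \<and>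
     (\<exists>S. mutually_singular N S \<and> (\<forall>B \<in> sets N. emeasure M B = emeasure A B + emeasure S B))"

text \<open>The space \<open>\<D>\<close>. Every finite Borel measure on the real line is Radon, so no regularity
  condition on \<open>\<mu>\<close> is needed.\<close>

definition space_D :: "((real \<Rightarrow> real) \<times> real measure) set" where
  "space_D = {(u, \<mu>).
     u \<in> bcontfun \<and> finite_measure \<mu> \<and> sets \<mu> = sets borel \<and>
     (\<exists>v. has_weak_deriv u v \<and> v \<in> borel_measurable lborel \<and> integrable lborel (\<lambda>x. (v x)\<^sup>2) \<and>
          is_ac_part lborel \<mu> (density lborel (\<lambda>x. ennreal ((v x)\<^sup>2))))}"

definition xbar :: "real measure \<Rightarrow> real \<Rightarrow> real" where
  "xbar \<mu> \<alpha> = (THE x. x + measure \<mu> {..<x} \<le> \<alpha> \<and> \<alpha> \<le> x + measure \<mu> {..x})"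

definition flow :: "(real \<Rightarrow> real) \<Rightarrow> real measure \<Rightarrow> real \<Rightarrow> real \<Rightarrow> real" where
  "flow u0 \<mu>0 \<alpha> t = xbar \<mu>0 \<alpha> + u0 (xbar \<mu>0 \<alpha>) * t
     + t\<^sup>2 / 4 * (\<alpha> - xbar \<mu>0 \<alpha> - measure \<mu>0 UNIV / 2)"

text \<open>\<open>(u, \<mu>)\<close> is the conservative solution with initial data \<open>(u0, \<mu>0)\<close>, given by its explicit
  formula along the characteristics \<open>flow u0 \<mu>0 \<alpha>\<close>. These sweep out the whole line at each time,
  so that the first clause determines \<open>u\<close> everywhere. The Lipschitz function \<open>xbar \<mu>0\<close> is
  differentiable almost everywhere only, and the value of \<open>deriv\<close> on the exceptional null set
  does not affect the density.\<close>

definition conservative_solution ::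
  "(real \<Rightarrow> real) \<Rightarrow> real measure \<Rightarrow> (real \<Rightarrow> real \<Rightarrow> real) \<Rightarrow> (real \<Rightarrow> real measure) \<Rightarrow> bool" where
  "conservative_solution u0 \<mu>0 u \<mu> \<longleftrightarrow>
     (\<forall>\<alpha> t x. x = flow u0 \<mu>0 \<alpha> t \<longrightarrow>
        u x t = u0 (xbar \<mu>0 \<alpha>) + t / 2 * (\<alpha> - xbar \<mu>0 \<alpha> - measure \<mu>0 UNIV / 2)) \<and>
     (\<forall>t. \<mu> t = distr (density lborel (\<lambda>\<alpha>. ennreal (1 - deriv (xbar \<mu>0) \<alpha>)))
                  borel (\<lambda>\<alpha>. flow u0 \<mu>0 \<alpha> t))"

end

theory Submission
  imports Defs "HOL-Probability.Distribution_Functions"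
begin

text \<open>
  Write \<open>M\<close> for the total mass of the initial measure \<open>\<mu>0\<close> and \<open>h \<alpha> = \<alpha> - xbar \<mu>0 \<alpha>\<close>,
  which is the mass to the left of \<open>xbar \<mu>0 \<alpha>\<close> plus a part of the atom at \<open>xbar \<mu>0 \<alpha>\<close>, if any.
  Both \<open>xbar \<mu>0\<close> and \<open>h\<close> are nondecreasing, so \<open>xbar \<mu>0\<close> is continuous. For every \<open>t\<close> some
  characteristic \<open>\<alpha> = a t\<close> passes through the given point \<open>x\<close> at time \<open>t\<close> (lemma
  \<open>flow_surj\<close>). Eliminating \<open>h (a t) - M / 2\<close> between the formulas for the characteristic and for
  the velocity along it gives

    \<open>u x t = 2 * (x - xbar \<mu>0 (a t)) / t - u0 (xbar \<mu>0 (a t))\<close>,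

  so it remains to see that \<open>xbar \<mu>0 (a t)\<close> stays bounded and that \<open>u0 (xbar \<mu>0 (a t))\<close> tends to
  \<open>u0 (xbar \<mu>0 \<alpha>s)\<close>.

  The term \<open>t\<^sup>2 / 4 * (h \<alpha> - M / 2)\<close> dominates the characteristic for large \<open>t\<close>, and it drives away from
  \<open>x\<close> every characteristic whose level \<open>h \<alpha>\<close> differs from \<open>M / 2\<close> by a fixed amount. Hence
  \<open>h (a t)\<close> tends to \<open>M / 2\<close> (lemma \<open>characteristic_level_tendsto\<close>). If \<open>M > 0\<close>, then \<open>h\<close> takes values
  on both sides of \<open>M / 2\<close>, and monotonicity confines \<open>a t\<close> to a compact interval.
  The level set \<open>h = M / 2\<close> need not be a single point, so \<open>a t\<close> itself may fail to converge. But the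
  image of this level set under \<open>xbar \<mu>0\<close> is an interval whose interior carries no mass of
  \<open>\<mu>0\<close>. The absolutely continuous part of \<open>\<mu>0\<close> has density \<open>v\<^sup>2\<close>, where \<open>v\<close> is the weak derivative
  of \<open>u0\<close>, so \<open>v\<close> vanishes there and \<open>u0\<close> is constant on this interval (lemma
  \<open>velocity_const_on_level\<close>). Convergence of \<open>u0 (xbar \<mu>0 (a t))\<close> then follows by compactness (lemma
  \<open>mono_level_tendsto_value\<close>).

  That a continuous function with vanishing weak derivative is constant is the lemma of du
  Bois-Reymond. It calls for test functions with prescribed derivative, which are built from
  \<open>exp (- 1 / x)\<close>.

  If \<open>M = 0\<close>, then \<open>h\<close> vanishes identically, the acceleration term is absent, and \<open>u\<close> is zero
  because \<open>u0\<close> is.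
\<close>

section \<open>Smooth functions of compact support\<close>

text \<open>The powers of \<open>1 / x\<close> are included because derivatives of \<open>exp (- 1 / x)\<close> produce them.\<close>

definition flat :: "nat \<Rightarrow> real \<Rightarrow> real" where
  "flat n x = (if x > 0 then (1 / x) ^ n * exp (- (1 / x)) else 0)"

lemma flat_tendsto_0: "(flat n \<longlongrightarrow> 0) (at 0)"
proof (rule filterlim_split_at)
  have "((\<lambda>x. (inverse x) ^ n / exp (inverse x)) \<longlongrightarrow> 0) (at_right (0::real))"
    by (rule filterlim_compose[OF tendsto_power_div_exp_0 filterlim_inverse_at_top_right])
  then show "(flat n \<longlongrightarrow> 0) (at_right 0)"
    by (rule filterlim_cong[THEN iffD1, rotated -1])
      (auto simp: flat_def exp_minus divide_simps eventually_at_filter)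
  show "(flat n \<longlongrightarrow> 0) (at_left 0)"
    by (rule tendsto_eventually) (auto simp: flat_def eventually_at_filter)
qed

lemma has_derivative_flat:
  "(flat n has_real_derivative (- real n * flat (n + 1) x + flat (n + 2) x)) (at x)"
proof -
  consider "x > 0" | "x < 0" | "x = 0" by linarith
  then show ?thesis
  proof cases
    case 1
    have inv: "((\<lambda>x. 1 / x) has_real_derivative - ((1 / x)\<^sup>2)) (at x)"
      using 1 by (auto intro!: derivative_eq_intros simp: power2_eq_square)
    have "((\<lambda>x. (1 / x) ^ n * exp (- (1 / x))) has_real_derivative
        (- (real n * (1 / x) ^ (n - 1) * (1 / x)\<^sup>2) * exp (- (1 / x))
          + (1 / x) ^ n * (1 / x)\<^sup>2 * exp (- (1 / x)))) (at x)"
      by (rule DERIV_cong[OF DERIV_mult[OF DERIV_power[OF inv] DERIV_fun_exp[OF DERIV_minus[OF inv]]]])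
        (simp add: algebra_simps)
    also have "- (real n * (1 / x) ^ (n - 1) * (1 / x)\<^sup>2) * exp (- (1 / x))
          + (1 / x) ^ n * (1 / x)\<^sup>2 * exp (- (1 / x)) = - real n * flat (n + 1) x + flat (n + 2) x"
      using 1 by (cases n) (simp_all add: flat_def power2_eq_square algebra_simps add_divide_distrib diff_divide_distrib)
    finally have "((\<lambda>x. (1 / x) ^ n * exp (- (1 / x))) has_real_derivative
        (- real n * flat (n + 1) x + flat (n + 2) x)) (at x)" .
    then show ?thesis
      by (rule has_field_derivative_transform_within_open[where S = "{0<..}"])
        (use 1 in \<open>auto simp: flat_def\<close>)
  next
    case 2
    have "(flat n has_real_derivative 0) (at x)"
      by (rule has_field_derivative_transform_within_open[where S = "{..<0}" and f = "\<lambda>x. 0"])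
        (use 2 in \<open>auto simp: flat_def\<close>)
    then show ?thesis using 2 by (simp add: flat_def)
  next
    case 3
    (* At the origin the difference quotient is again a function of the same family. *)
    have "(\<lambda>h. (flat n (0 + h) - flat n 0) / h) = flat (n + 1)"
      by (auto simp: flat_def)
    then have "(flat n has_real_derivative 0) (at 0)"
      using flat_tendsto_0[of "n + 1"] by (simp add: DERIV_def)
    then show ?thesis using 3 by (simp add: flat_def)
  qed
qed

text \<open>
  A class of functions that is visibly stable under differentiation consists of smooth functions.
  Closing the flat functions under exactly the operations needed for test functions, instead of
  proving the Leibniz and chain rules for derivatives of all orders, makes smoothness of all
  these functions one induction.
\<close>

inductive smooth_closure :: "(real \<Rightarrow> real) \<Rightarrow> bool" where
  flat: "smooth_closure (flat n)"
| const: "smooth_closure (\<lambda>x. c)"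
| add: "smooth_closure f \<Longrightarrow> smooth_closure g \<Longrightarrow> smooth_closure (\<lambda>x. f x + g x)"
| mult: "smooth_closure f \<Longrightarrow> smooth_closure g \<Longrightarrow> smooth_closure (\<lambda>x. f x * g x)"
| affine: "smooth_closure f \<Longrightarrow> smooth_closure (\<lambda>x. f (a * x + b))"
| antideriv: "(\<And>x. (F has_real_derivative f x) (at x)) \<Longrightarrow> smooth_closure f \<Longrightarrow> smooth_closure F"

lemma smooth_closure_has_derivative:
  assumes "smooth_closure f"
  shows "\<exists>f'. smooth_closure f' \<and> (\<forall>x. (f has_real_derivative f' x) (at x))"
  using assms
proof induction
  case (flat n)
  show ?case
    by (intro exI[of _ "\<lambda>x. - real n * flat (n + 1) x + flat (n + 2) x"] conjI allI
      has_derivative_flat smooth_closure.add smooth_closure.mult smooth_closure.const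
      smooth_closure.flat)
next
  case (const c)
  then show ?case
    by (intro exI[of _ "\<lambda>x. 0"]) (auto intro: smooth_closure.const)
next
  case (add f g)
  then obtain f' g' where "smooth_closure f'" "smooth_closure g'"
    "\<And>x. (f has_real_derivative f' x) (at x)" "\<And>x. (g has_real_derivative g' x) (at x)" by blast
  then show ?case
    by (intro exI[of _ "\<lambda>x. f' x + g' x"])
      (auto intro!: smooth_closure.add derivative_eq_intros)
next
  case (mult f g)
  then obtain f' g' where "smooth_closure f'" "smooth_closure g'"
    "\<And>x. (f has_real_derivative f' x) (at x)" "\<And>x. (g has_real_derivative g' x) (at x)" by blast
  with mult.hyps show ?case
    by (intro exI[of _ "\<lambda>x. f' x * g x + f x * g' x"])
      (auto intro!: smooth_closure.add smooth_closure.mult derivative_eq_intros)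
next
  case (affine f a b)
  then obtain f' where f': "smooth_closure f'" "\<And>x. (f has_real_derivative f' x) (at x)" by blast
  have "((\<lambda>x. f (a * x + b)) has_real_derivative f' (a * x + b) * a) (at x)" for x
    by (rule DERIV_chain2[OF f'(2)]) (auto intro!: derivative_eq_intros)
  with f' show ?case
    by (intro exI[of _ "\<lambda>x. f' (a * x + b) * a"])
      (auto intro!: smooth_closure.mult smooth_closure.const smooth_closure.affine)
next
  case (antideriv F f)
  then show ?case by blast
qed

lemma smooth_closure_deriv: "smooth_closure f \<Longrightarrow> smooth_closure (deriv f)"
proof -
  assume "smooth_closure f"
  then obtain f' where f': "smooth_closure f'" "\<forall>x. (f has_real_derivative f' x) (at x)"
    using smooth_closure_has_derivative by blast
  then have "deriv f = f'" by (auto intro: DERIV_imp_deriv)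
  with f' show ?thesis by simp
qed

lemma smooth_closure_differentiable: "smooth_closure f \<Longrightarrow> f differentiable (at x)"
  using smooth_closure_has_derivative real_differentiable_def by blast

lemma smooth_closure_continuous: "smooth_closure f \<Longrightarrow> continuous_on S f"
  by (meson continuous_at_imp_continuous_on differentiable_imp_continuous_within
      smooth_closure_differentiable)

lemma smooth_closure_imp_test_fun:
  assumes "smooth_closure f" and supp: "\<And>x. x \<notin> {a..b} \<Longrightarrow> f x = 0"
  shows "test_fun f"
proof -
  have "smooth_closure ((deriv ^^ k) f)" for k
    by (induction k) (auto intro: assms smooth_closure_deriv)
  moreover have "closure {x. f x \<noteq> 0} \<subseteq> {a..b}"
    by (rule closure_minimal) (use supp in blast, simp)
  then have "compact (closure {x. f x \<noteq> 0})"
    using compact_Icc[of a b] compact_Int_closed[of "{a..b}" "closure {x. f x \<noteq> 0}"]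
    by (simp add: Int_absorb1)
  ultimately show ?thesis
    using smooth_closure_differentiable unfolding test_fun_def by blast
qed

text \<open>
  The bump is \<open>flat 0 (x + \<epsilon>) * flat 0 (\<epsilon> - x)\<close>. Its antiderivative \<open>F\<close> is constant on either side of
  the support, so the difference of two translates of \<open>F\<close> is a test function.
\<close>

lemma exists_bump_with_antiderivative:
  assumes "\<epsilon> > 0"
  obtains \<psi> F where "smooth_closure \<psi>" "smooth_closure F"
    "\<And>x. (F has_real_derivative \<psi> x) (at x)"
    "\<And>x. \<psi> x \<ge> 0" "\<And>x. \<psi> x > 0 \<longleftrightarrow> \<bar>x\<bar> < \<epsilon>"
proof -
  define \<psi> where "\<psi> x = flat 0 (1 * x + \<epsilon>) * flat 0 (- 1 * x + \<epsilon>)" for x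
  have smooth: "smooth_closure \<psi>"
    unfolding \<psi>_def
    by (intro smooth_closure.mult smooth_closure.affine[of "flat 0"] smooth_closure.flat)
  have "isCont \<psi> x" for x
    using smooth_closure_continuous[OF smooth, of UNIV]
    by (simp add: continuous_on_eq_continuous_at)
  then have "\<exists>F. \<forall>x. (F has_real_derivative \<psi> x) (at x)"
    using einterval_antiderivative[of "-\<infinity>" "\<infinity>" \<psi>]
    by (simp add: has_real_derivative_iff_has_vector_derivative)
  then obtain F where F: "\<And>x. (F has_real_derivative \<psi> x) (at x)" by blast
  have "\<psi> x \<ge> 0" "\<psi> x > 0 \<longleftrightarrow> \<bar>x\<bar> < \<epsilon>" for x
    by (auto simp: \<psi>_def flat_def)
  then show ?thesis
    using that smooth smooth_closure.antideriv[OF F smooth] F by blast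
qed

section \<open>Vanishing weak derivatives\<close>

lemma integrable_continuous_compact_support:
  fixes f :: "real \<Rightarrow> real"
  assumes "continuous_on UNIV f" "\<And>x. x \<notin> {a..b} \<Longrightarrow> f x = 0"
  shows "integrable lborel f"
proof -
  have "integrable lborel (\<lambda>x. f x * indicator {a..b} x)"
    by (rule borel_integrable_atLeastAtMost)
      (use assms(1) in \<open>auto simp: continuous_on_eq_continuous_at\<close>)
  moreover have "(\<lambda>x. f x * indicator {a..b} x) = f"
    using assms(2) by (auto simp: indicator_def fun_eq_iff)
  ultimately show ?thesis by simp
qed

text \<open>
  Testing a continuous function against a narrow bump at \<open>r\<close> nearly evaluates it at \<open>r\<close>; the factor
  \<open>LINT x|lborel. \<psi> x\<close> is the same for all \<open>r\<close> by translation invariance.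
\<close>

lemma integral_against_bump:
  fixes u :: "real \<Rightarrow> real"
  assumes cont: "continuous_on UNIV u" "continuous_on UNIV \<psi>"
    and nonneg: "\<And>x. \<psi> x \<ge> 0" and supp: "\<And>x. \<psi> x > 0 \<Longrightarrow> \<bar>x\<bar> < \<epsilon>"
    and near: "\<And>x. \<bar>x - r\<bar> < \<epsilon> \<Longrightarrow> \<bar>u x - u r\<bar> \<le> e"
  shows "integrable lborel (\<lambda>x. u x * \<psi> (x - r))"
    and "\<bar>(LINT x|lborel. u x * \<psi> (x - r)) - u r * (LINT x|lborel. \<psi> x)\<bar>
           \<le> e * (LINT x|lborel. \<psi> x)"
proof -
  have zero: "\<psi> x = 0" if "\<not> \<bar>x\<bar> < \<epsilon>" for x
    using supp[of x] nonneg[of x] that by linarith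
  have cont': "continuous_on UNIV (\<lambda>x. \<psi> (x - r))"
    by (intro continuous_on_compose2[OF cont(2)] continuous_intros) auto
  have int: "integrable lborel (\<lambda>x. \<psi> (x - r))"
    by (rule integrable_continuous_compact_support[OF cont', of "r - \<epsilon>" "r + \<epsilon>"])
      (auto intro!: zero)
  show intu: "integrable lborel (\<lambda>x. u x * \<psi> (x - r))"
    by (rule integrable_continuous_compact_support[of _ "r - \<epsilon>" "r + \<epsilon>"])
      (auto intro!: zero continuous_intros cont cont')
  have shift: "(LINT x|lborel. \<psi> (x - r)) = (LINT x|lborel. \<psi> x)"
    using lborel_integral_real_affine[of 1 "\<lambda>x. \<psi> (x - r)" r] by simp
  have bound: "(u r - e) * \<psi> (x - r) \<le> u x * \<psi> (x - r)"
    "u x * \<psi> (x - r) \<le> (u r + e) * \<psi> (x - r)" for x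
  proof -
    have "u r - e \<le> u x \<and> u x \<le> u r + e" if "\<bar>x - r\<bar> < \<epsilon>"
      using near[OF that] by auto
    then show "(u r - e) * \<psi> (x - r) \<le> u x * \<psi> (x - r)"
      "u x * \<psi> (x - r) \<le> (u r + e) * \<psi> (x - r)"
      using zero[of "x - r"] nonneg[of "x - r"]
      by (cases "\<bar>x - r\<bar> < \<epsilon>"; auto intro!: mult_right_mono)+
  qed
  have "(LINT x|lborel. (u r - e) * \<psi> (x - r)) \<le> (LINT x|lborel. u x * \<psi> (x - r))"
    "(LINT x|lborel. u x * \<psi> (x - r)) \<le> (LINT x|lborel. (u r + e) * \<psi> (x - r))"
    by (rule integral_mono; use int intu bound in auto)+
  then have "(u r - e) * (LINT x|lborel. \<psi> x) \<le> (LINT x|lborel. u x * \<psi> (x - r))"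
    "(LINT x|lborel. u x * \<psi> (x - r)) \<le> (u r + e) * (LINT x|lborel. \<psi> x)"
    by (simp_all add: shift)
  then show "\<bar>(LINT x|lborel. u x * \<psi> (x - r)) - u r * (LINT x|lborel. \<psi> x)\<bar>
           \<le> e * (LINT x|lborel. \<psi> x)"
    by (simp add: algebra_simps abs_le_iff)
qed

text \<open>
  The argument is that of du Bois-Reymond: if \<open>\<phi>\<close> is a test function supported in the interval with
  \<open>\<phi>' x = \<psi> (x - p) - \<psi> (x - q)\<close>, then \<open>u\<close> has the same integral against the bumps at \<open>p\<close> and at
  \<open>q\<close>. Narrow bumps would tell \<open>u p\<close> and \<open>u q\<close> apart if they were different.
\<close>

lemma weak_deriv_zero_imp_eq:
  assumes weak: "has_weak_deriv u v" and cont: "continuous_on UNIV u"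
    and zero: "AE x in lborel. x \<in> {c<..<d} \<longrightarrow> v x = 0"
    and pq: "c < p" "p < q" "q < d"
  shows "u p = u q"
proof (rule ccontr)
  assume "u p \<noteq> u q"
  (* Each of the two bumps costs an error e, so a third of the gap keeps 2 * e below it. *)
  define e where "e = \<bar>u p - u q\<bar> / 3"
  then have "e > 0" using \<open>u p \<noteq> u q\<close> by simp
  have "\<exists>\<delta>>0. \<forall>x. \<bar>x - r\<bar> < \<delta> \<longrightarrow> \<bar>u x - u r\<bar> \<le> e" for r
    using cont \<open>e > 0\<close> unfolding continuous_on_iff by (metis UNIV_I dist_real_def less_imp_le)
  then obtain \<delta>p \<delta>q where \<delta>: "\<delta>p > 0" "\<And>x. \<bar>x - p\<bar> < \<delta>p \<Longrightarrow> \<bar>u x - u p\<bar> \<le> e"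
     "\<delta>q > 0" "\<And>x. \<bar>x - q\<bar> < \<delta>q \<Longrightarrow> \<bar>u x - u q\<bar> \<le> e" by metis
  define \<rho> where "\<rho> = min ((p - c) / 2) ((d - q) / 2)"
  define \<epsilon> where "\<epsilon> = min (min \<delta>p \<delta>q) \<rho>"
  have "\<rho> > 0" "c < p - \<rho>" "q + \<rho> < d"
    using pq by (auto simp: \<rho>_def min_def field_simps)
  moreover have "\<epsilon> \<le> \<rho>" by (simp add: \<epsilon>_def)
  ultimately have \<epsilon>: "\<epsilon> > 0" "\<epsilon> \<le> \<delta>p" "\<epsilon> \<le> \<delta>q" "c < p - \<epsilon>" "q + \<epsilon> < d"
    using \<delta>(1,3) by (auto simp: \<epsilon>_def)
  obtain \<psi> F where \<psi>: "smooth_closure \<psi>" "\<And>x. \<psi> x \<ge> 0" "\<And>x. \<psi> x > 0 \<longleftrightarrow> \<bar>x\<bar> < \<epsilon>"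
    and F: "smooth_closure F" "\<And>x. (F has_real_derivative \<psi> x) (at x)"
    using exists_bump_with_antiderivative[OF \<epsilon>(1)] by metis
  have \<psi>0: "\<psi> x = 0" if "\<bar>x\<bar> \<ge> \<epsilon>" for x
    using \<psi>(2,3)[of x] that by linarith
  have F_const: "F y = F x" if "x \<le> y" "\<And>z. x < z \<Longrightarrow> z < y \<Longrightarrow> \<bar>z\<bar> \<ge> \<epsilon>" for x y
  proof (cases "x < y")
    case True
    then show ?thesis
    proof (rule DERIV_isconst_end)
      show "(F has_real_derivative 0) (at z)" if "x < z" "z < y" for z
        using F(2)[of z] \<psi>0[of z] that \<open>\<And>z. x < z \<Longrightarrow> z < y \<Longrightarrow> \<bar>z\<bar> \<ge> \<epsilon>\<close> by simp
    qed (rule smooth_closure_continuous[OF F(1)])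
  qed (use that in simp)
  have F_left: "F x = F (- \<epsilon>)" if "x \<le> - \<epsilon>" for x
    using F_const[of x "- \<epsilon>"] that by simp
  have F_right: "F x = F \<epsilon>" if "x \<ge> \<epsilon>" for x
    using F_const[of \<epsilon> x] that by simp
  define \<phi> where "\<phi> x = F (1 * x + - p) + (- 1) * F (1 * x + - q)" for x
  have \<phi>_smooth: "smooth_closure \<phi>"
    unfolding \<phi>_def
    by (intro smooth_closure.add smooth_closure.mult smooth_closure.const
        smooth_closure.affine[of F] F)
  have \<phi>0: "\<phi> x = 0" if "x \<notin> {p - \<epsilon>..q + \<epsilon>}" for x
    using that F_left[of "x - p"] F_left[of "x - q"] F_right[of "x - p"] F_right[of "x - q"] pq \<epsilon>
    by (auto simp: \<phi>_def)
  have "(\<phi> has_real_derivative \<psi> (x - p) - \<psi> (x - q)) (at x)" for x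
    unfolding \<phi>_def by (auto intro!: derivative_eq_intros DERIV_chain2[OF F(2)])
  then have d\<phi>: "deriv \<phi> x = \<psi> (x - p) - \<psi> (x - q)" for x
    by (rule DERIV_imp_deriv)
  have "(LINT x|lborel. u x * deriv \<phi> x) = - (LINT x|lborel. v x * \<phi> x)"
    using weak smooth_closure_imp_test_fun[OF \<phi>_smooth \<phi>0] unfolding has_weak_deriv_def by blast
  also have "(LINT x|lborel. v x * \<phi> x) = 0"
  proof (rule integral_eq_zero_AE)
    show "AE x in lborel. v x * \<phi> x = 0"
      using zero by eventually_elim (use \<phi>0 \<epsilon> in force)
  qed
  finally have "(LINT x|lborel. u x * \<psi> (x - p) - u x * \<psi> (x - q)) = 0"
    by (simp add: d\<phi> right_diff_distrib)
  moreover note \<psi>c = smooth_closure_continuous[OF \<psi>(1), of UNIV]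
  note P = integral_against_bump[OF cont \<psi>c \<psi>(2), of \<epsilon> p e]
  note Q = integral_against_bump[OF cont \<psi>c \<psi>(2), of \<epsilon> q e]
  define C where "C = (LINT x|lborel. \<psi> x)"
  have near: "\<And>x. \<bar>x - p\<bar> < \<epsilon> \<Longrightarrow> \<bar>u x - u p\<bar> \<le> e" "\<And>x. \<bar>x - q\<bar> < \<epsilon> \<Longrightarrow> \<bar>u x - u q\<bar> \<le> e"
    using \<delta> \<epsilon> by auto
  ultimately have "(LINT x|lborel. u x * \<psi> (x - p)) = (LINT x|lborel. u x * \<psi> (x - q))"
    using P(1) Q(1) \<psi>(3) near by (subst (asm) Bochner_Integration.integral_diff) auto
  then have "\<bar>u p * C - u q * C\<bar> \<le> 2 * (e * C)"
    using P(2) Q(2) \<psi>(3) near unfolding C_def[symmetric] by fastforce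
  moreover have "C > 0"
  proof -
    have int: "integrable lborel \<psi>"
      by (rule integrable_continuous_compact_support[OF \<psi>c, of "- \<epsilon>" \<epsilon>])
        (use \<psi>0 in \<open>auto simp: abs_if\<close>)
    have "C \<noteq> 0"
    proof
      assume "C = 0"
      then have "AE x in lborel. \<psi> x = 0"
        using int \<psi>(2) unfolding C_def by (subst (asm) integral_nonneg_eq_0_iff_AE) auto
      then have "AE x in lborel. x \<notin> {- \<epsilon><..<\<epsilon>}"
      proof eventually_elim
        case (elim x)
        then show ?case using \<psi>(3)[of x] by (auto simp: abs_less_iff)
      qed
      then have "emeasure lborel {- \<epsilon><..<\<epsilon>} = 0"
        by (subst (asm) AE_iff_measurable[of "{- \<epsilon><..<\<epsilon>}"]) auto
      then show False using \<epsilon> by simp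
    qed
    moreover have "C \<ge> 0" unfolding C_def using \<psi>(2) by simp
    ultimately show ?thesis by simp
  qed
  ultimately show False
  proof -
    assume "\<bar>u p * C - u q * C\<bar> \<le> 2 * (e * C)" "C > 0"
    then have "3 * e * C \<le> 2 * e * C"
      by (simp add: e_def abs_mult flip: left_diff_distrib)
    with \<open>C > 0\<close> \<open>e > 0\<close> show False by simp
  qed
qed


section \<open>The parametrization by mass and position\<close>

lemma (in finite_borel_measure) measure_atMost_le_lessThan:
  "x < y \<Longrightarrow> measure M {..x} \<le> measure M {..<y}"
  by (rule finite_measure_mono) auto

lemma (in finite_borel_measure) measure_lessThan_le_atMost:
  "measure M {..<x} \<le> measure M {..x}"
  by (rule finite_measure_mono) auto

text \<open>
  This comparison gives uniqueness of the number defining \<open>xbar\<close> (for \<open>\<alpha> = \<beta>\<close>), its monotonicity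
  in \<open>\<alpha>\<close>, and its value at points where it can be guessed.
\<close>

lemma (in finite_borel_measure) xbar_candidates_mono:
  assumes "x + measure M {..<x} \<le> \<alpha>" "\<beta> \<le> y + measure M {..y}" "\<alpha> \<le> \<beta>"
  shows "x \<le> y"
  using assms measure_atMost_le_lessThan[of y x] by linarith

text \<open>
  The supremum of all \<open>x\<close> with \<open>x + measure M {..<x} \<le> \<alpha>\<close> is such a number: the two
  inequalities are the one-sided limits of \<open>y + cdf M y\<close> at the supremum.
\<close>

lemma (in finite_borel_measure) xbar_candidate_exists:
  "\<exists>x. x + measure M {..<x} \<le> \<alpha> \<and> \<alpha> \<le> x + measure M {..x}"
proof -
  define S where "S = {x. x + measure M {..<x} \<le> \<alpha>}"
  define s where "s = Sup S"
  have bdd: "bdd_above S"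
    unfolding bdd_above_def
  proof (intro exI ballI)
    show "x \<le> \<alpha>" if "x \<in> S" for x
      using that measure_nonneg[of M "{..<x}"] unfolding S_def mem_Collect_eq by linarith
  qed
  have "\<alpha> - measure M (space M) \<in> S"
    using bounded_measure[of "{..<\<alpha> - measure M (space M)}"] by (simp add: S_def)
  then have ne: "S \<noteq> {}" by blast
  have "s + measure M {..<s} \<le> \<alpha>"
  proof (rule tendsto_upperbound)
    show "((\<lambda>y. y + cdf M y) \<longlongrightarrow> s + measure M {..<s}) (at_left s)"
      by (intro tendsto_intros cdf_at_left)
    have "y + cdf M y \<le> \<alpha>" if "y < s" for y
    proof -
      obtain z where "z \<in> S" "y < z"
        using \<open>y < s\<close> less_cSup_iff[OF ne bdd] unfolding s_def by blast
      then show ?thesis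
        using measure_atMost_le_lessThan[of y z] by (simp add: S_def cdf_def)
    qed
    then show "\<forall>\<^sub>F y in at_left s. y + cdf M y \<le> \<alpha>"
      by (simp add: eventually_at_filter)
  qed simp
  moreover have "\<alpha> \<le> s + measure M {..s}"
  proof (rule tendsto_lowerbound)
    have "(cdf M \<longlongrightarrow> cdf M s) (at_right s)"
      using cdf_is_right_cont by (simp add: continuous_within)
    then show "((\<lambda>y. y + cdf M y) \<longlongrightarrow> s + measure M {..s}) (at_right s)"
      unfolding cdf_def[symmetric] by (intro tendsto_intros) (simp add: cdf_def[abs_def])
    have "\<alpha> \<le> y + cdf M y" if "s < y" for y
    proof -
      have "y \<notin> S" using that cSup_upper[OF _ bdd] unfolding s_def by fastforce
      then show ?thesis
        using measure_lessThan_le_atMost[of y] by (simp add: S_def cdf_def)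
    qed
    then show "\<forall>\<^sub>F y in at_right s. \<alpha> \<le> y + cdf M y"
      by (simp add: eventually_at_filter)
  qed simp
  ultimately show ?thesis by blast
qed

lemma (in finite_borel_measure) xbar_bounds:
  "xbar M \<alpha> + measure M {..<xbar M \<alpha>} \<le> \<alpha>" "\<alpha> \<le> xbar M \<alpha> + measure M {..xbar M \<alpha>}"
proof -
  have "\<exists>!x. x + measure M {..<x} \<le> \<alpha> \<and> \<alpha> \<le> x + measure M {..x}"
    using xbar_candidate_exists[of \<alpha>] xbar_candidates_mono[of _ \<alpha> \<alpha>]
    by (metis order_antisym order_refl)
  from theI'[OF this]
  show "xbar M \<alpha> + measure M {..<xbar M \<alpha>} \<le> \<alpha>" "\<alpha> \<le> xbar M \<alpha> + measure M {..xbar M \<alpha>}"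
    unfolding xbar_def by blast+
qed

lemma (in finite_borel_measure) xbar_mono: "\<alpha> \<le> \<beta> \<Longrightarrow> xbar M \<alpha> \<le> xbar M \<beta>"
  using xbar_candidates_mono[OF xbar_bounds(1) xbar_bounds(2)] .

lemma (in finite_borel_measure) xbar_cdf: "xbar M (x + cdf M x) = x"
proof (rule antisym)
  show "xbar M (x + cdf M x) \<le> x"
    by (rule xbar_candidates_mono[OF xbar_bounds(1)]) (auto simp: cdf_def)
  show "x \<le> xbar M (x + cdf M x)"
    by (rule xbar_candidates_mono[OF _ xbar_bounds(2)]) (auto simp: cdf_def measure_lessThan_le_atMost)
qed

lemma (in finite_borel_measure) xbar_defect_bounds:
  "0 \<le> \<alpha> - xbar M \<alpha>" "\<alpha> - xbar M \<alpha> \<le> measure M UNIV"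
  using xbar_bounds[of \<alpha>] measure_nonneg[of M "{..<xbar M \<alpha>}"]
    bounded_measure[of "{..xbar M \<alpha>}"] unfolding borel_UNIV by linarith+

text \<open>
  If \<open>xbar M\<close> moves from \<open>\<alpha>\<close> to \<open>\<beta>\<close>, the open left half-line at its new position contains the closed
  one at its old position, and these masses bound the two defects from the proper sides. Together
  with monotonicity of \<open>xbar M\<close> this is the Lipschitz bound with constant one.
\<close>

lemma (in finite_borel_measure) xbar_defect_mono:
  assumes "\<alpha> \<le> \<beta>"
  shows "\<alpha> - xbar M \<alpha> \<le> \<beta> - xbar M \<beta>"
proof (cases "xbar M \<alpha> = xbar M \<beta>")
  case False
  then have "xbar M \<alpha> < xbar M \<beta>" using xbar_mono[OF assms] by simp
  from measure_atMost_le_lessThan[OF this] show ?thesis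
    using xbar_bounds(2)[of \<alpha>] xbar_bounds(1)[of \<beta>] by linarith
qed (use assms in simp)

lemma (in finite_borel_measure) xbar_continuous: "continuous_on S (xbar M)"
proof -
  have "\<bar>xbar M \<alpha> - xbar M \<beta>\<bar> \<le> \<bar>\<alpha> - \<beta>\<bar>" for \<alpha> \<beta>
    using xbar_mono[of \<alpha> \<beta>] xbar_mono[of \<beta> \<alpha>] xbar_defect_mono[of \<alpha> \<beta>] xbar_defect_mono[of \<beta> \<alpha>]
    by (cases "\<alpha> \<le> \<beta>") auto
  then have "1-lipschitz_on S (xbar M)"
    by (intro lipschitz_onI) (auto simp: dist_real_def)
  then show ?thesis by (rule lipschitz_on_continuous_on)
qed

lemma (in finite_borel_measure) xbar_defect_attains_around:
  assumes "0 < m" "m < measure M UNIV"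
  obtains A B where "A - xbar M A < m" "m < B - xbar M B"
proof -
  have "\<forall>\<^sub>F z in at_bot. cdf M z < m" "\<forall>\<^sub>F z in at_top. m < cdf M z"
    using order_tendstoD(2)[OF cdf_lim_at_bot] order_tendstoD(1)[OF cdf_lim_at_top] assms
    by (auto simp: borel_UNIV)
  then obtain z z' where "cdf M z < m" "m < cdf M z'"
    by (meson eventually_happens' trivial_limit_at_bot_linorder trivial_limit_at_top_linorder)
  then show ?thesis
    using that[of "z + cdf M z" "z' + cdf M z'"] by (simp add: xbar_cdf)
qed

text \<open>
  The defect grows from \<open>\<alpha>\<close> to \<open>\<beta>\<close> by at least the mass strictly between the two positions, so none
  is left there when it does not grow. Only the open interval is free of mass: atoms at its end
  points are possible.
\<close>

lemma (in finite_borel_measure) measure_between_xbar_eq_0: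
  assumes "\<alpha> - xbar M \<alpha> = \<beta> - xbar M \<beta>"
  shows "measure M {xbar M \<alpha><..<xbar M \<beta>} = 0"
proof (cases "xbar M \<alpha> < xbar M \<beta>")
  case True
  have "measure M ({..xbar M \<alpha>} \<union> {xbar M \<alpha><..<xbar M \<beta>})
      = measure M {..xbar M \<alpha>} + measure M {xbar M \<alpha><..<xbar M \<beta>}"
    by (rule finite_measure_Union) auto
  also have "{..xbar M \<alpha>} \<union> {xbar M \<alpha><..<xbar M \<beta>} = {..<xbar M \<beta>}"
    using True by auto
  finally show ?thesis
    using xbar_bounds(2)[of \<alpha>] xbar_bounds(1)[of \<beta>] assms
      measure_nonneg[of M "{xbar M \<alpha><..<xbar M \<beta>}"] by linarith
qed simp

section \<open>Characteristics\<close>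

text \<open>
  At a fixed time \<open>flow u0 M \<alpha> t\<close> stays within a bounded distance of \<open>\<alpha>\<close>, so the intermediate value
  theorem applies.
\<close>

lemma flow_surj:
  assumes M: "finite_borel_measure M" and cont: "continuous_on UNIV u0"
    and bound: "\<And>z. \<bar>u0 z\<bar> \<le> C"
  shows "\<exists>\<alpha>. flow u0 M \<alpha> t = x"
proof -
  interpret finite_borel_measure M by (rule M)
  define K where "K = C * \<bar>t\<bar> + t\<^sup>2 / 4 * measure M UNIV + measure M UNIV"
  have cont: "continuous_on S (\<lambda>\<alpha>. flow u0 M \<alpha> t)" for S
    unfolding flow_def
    by (intro continuous_intros xbar_continuous continuous_on_compose2[OF cont xbar_continuous]) auto
  have near: "\<bar>flow u0 M \<alpha> t - \<alpha>\<bar> \<le> K" for \<alpha>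
  proof -
    note h = xbar_defect_bounds[of \<alpha>]
    have "\<bar>u0 (xbar M \<alpha>) * t\<bar> \<le> C * \<bar>t\<bar>"
      using bound by (simp add: abs_mult mult_right_mono)
    moreover have "\<bar>t\<^sup>2 / 4 * (\<alpha> - xbar M \<alpha> - measure M UNIV / 2)\<bar> \<le> t\<^sup>2 / 4 * measure M UNIV"
      unfolding abs_mult by (intro mult_mono) (use h in \<open>auto simp: abs_le_iff\<close>)
    ultimately show ?thesis
      using h unfolding flow_def K_def by linarith
  qed
  have "\<exists>\<alpha>\<ge>x - K. \<alpha> \<le> x + K \<and> flow u0 M \<alpha> t = x"
    by (rule IVT') (use near[of "x - K"] near[of "x + K"] cont in auto)
  then show ?thesis by blast
qed


text \<open>
  Equality of the defects empties the open interval between the two positions of mass, so the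
  density \<open>v\<^sup>2\<close> of the absolutely continuous part vanishes there almost everywhere; continuity of
  \<open>u0\<close> extends the conclusion to the end points.
\<close>

lemma velocity_const_on_level:
  assumes data: "(u0, M) \<in> space_D"
    and level: "\<alpha> - xbar M \<alpha> = \<beta> - xbar M \<beta>"
    and less: "xbar M \<alpha> < xbar M \<beta>"
  shows "u0 (xbar M \<alpha>) = u0 (xbar M \<beta>)"
proof -
  interpret finite_borel_measure M
    using data by (auto simp: space_D_def finite_borel_measure_def finite_borel_measure_axioms_def)
  obtain v where weak: "has_weak_deriv u0 v" and v [measurable]: "v \<in> borel_measurable lborel"
    and ac: "is_ac_part lborel M (density lborel (\<lambda>x. ennreal ((v x)\<^sup>2)))"
    using data by (auto simp: space_D_def)
  have cont: "continuous_on S u0" for S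
    using data continuous_on_subset[of UNIV u0 S] by (auto simp: space_D_def bcontfun_def)
  define I where "I = {xbar M \<alpha><..<xbar M \<beta>}"
  have "emeasure M I = 0"
    using measure_between_xbar_eq_0[OF level] by (simp add: I_def emeasure_eq_measure)
  moreover have "I \<in> sets lborel" by (simp add: I_def)
  moreover obtain S where "\<And>B. B \<in> sets lborel \<Longrightarrow>
      emeasure M B = emeasure (density lborel (\<lambda>x. ennreal ((v x)\<^sup>2))) B + emeasure S B"
    using ac unfolding is_ac_part_def by blast
  ultimately have "emeasure (density lborel (\<lambda>x. ennreal ((v x)\<^sup>2))) I = 0"
    by simp
  then have "(\<integral>\<^sup>+ x. ennreal ((v x)\<^sup>2) * indicator I x \<partial>lborel) = 0"
    using \<open>I \<in> sets lborel\<close> by (subst (asm) emeasure_density) auto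
  then have "AE x in lborel. ennreal ((v x)\<^sup>2) * indicator I x = 0"
    using \<open>I \<in> sets lborel\<close> by (subst (asm) nn_integral_0_iff_AE) auto
  then have zero: "AE x in lborel. x \<in> {xbar M \<alpha><..<xbar M \<beta>} \<longrightarrow> v x = 0"
    by eventually_elim (auto simp: I_def)
  define m where "m = (xbar M \<alpha> + xbar M \<beta>) / 2"
  have m: "xbar M \<alpha> < m" "m < xbar M \<beta>" using less by (auto simp: m_def)
  have inner: "u0 p = u0 m" if "p \<in> {xbar M \<alpha><..<xbar M \<beta>}" for p
  proof (cases p m rule: linorder_cases)
    case less
    then show ?thesis using weak_deriv_zero_imp_eq[OF weak cont zero, of p m] that m by simp
  next
    case greater
    then show ?thesis using weak_deriv_zero_imp_eq[OF weak cont zero, of m p] that m by simp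
  qed simp
  have "u0 p = u0 m" if "p \<in> {xbar M \<alpha>..xbar M \<beta>}" for p
  proof (rule continuous_constant_on_closure[OF cont inner])
    show "p \<in> closure {xbar M \<alpha><..<xbar M \<beta>}"
      using that less by (simp add: closure_greaterThanLessThan)
  qed
  from this[of "xbar M \<alpha>"] this[of "xbar M \<beta>"] show ?thesis using less by simp
qed

text \<open>
  The points of \<open>{A..B}\<close> where \<open>g\<close> is at least \<open>e\<close> away from \<open>k\<close> form a compact set on which \<open>h\<close>
  avoids \<open>m\<close>. The image of this set under \<open>h\<close> is closed, so \<open>h (a t)\<close> eventually leaves it.
\<close>

lemma mono_level_tendsto_value:
  fixes h g :: "real \<Rightarrow> real"
  assumes cont: "continuous_on UNIV h" "continuous_on UNIV g" and "mono h"
    and AB: "h A < m" "m < h B"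
    and level: "\<And>\<alpha>. h \<alpha> = m \<Longrightarrow> g \<alpha> = k"
    and lim: "((\<lambda>t. h (a t)) \<longlongrightarrow> m) F"
  shows "\<forall>\<^sub>F t in F. a t \<in> {A..B}" and "((\<lambda>t. g (a t)) \<longlongrightarrow> k) F"
proof -
  show inside: "\<forall>\<^sub>F t in F. a t \<in> {A..B}"
    using order_tendstoD(1)[OF lim AB(1)] order_tendstoD(2)[OF lim AB(2)]
  proof eventually_elim
    case (elim t)
    then show ?case
      using monoD[OF \<open>mono h\<close>, of "a t" A] monoD[OF \<open>mono h\<close>, of B "a t"] by force
  qed
  show "((\<lambda>t. g (a t)) \<longlongrightarrow> k) F"
  proof (rule tendstoI)
    fix e :: real assume "e > 0"
    define K where "K = {A..B} \<inter> {\<alpha>. e \<le> dist (g \<alpha>) k}"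
    have "closed {\<alpha>. e \<le> dist (g \<alpha>) k}"
      by (intro closed_Collect_le continuous_intros cont)
    then have "compact (h ` K)"
      unfolding K_def
      by (intro compact_continuous_image continuous_on_subset[OF cont(1)] compact_Int_closed) auto
    then have "open (- h ` K)" by (simp add: compact_imp_closed open_Compl)
    moreover have "m \<in> - h ` K" using level \<open>e > 0\<close> by (auto simp: K_def)
    ultimately have "\<forall>\<^sub>F t in F. h (a t) \<in> - h ` K"
      by (rule topological_tendstoD[OF lim])
    with inside show "\<forall>\<^sub>F t in F. dist (g (a t)) k < e"
      by eventually_elim (auto simp: K_def not_le)
  qed
qed

text \<open>
  If the level of \<open>a t\<close> exceeds that of \<open>\<alpha>s\<close> by \<open>e\<close>, then \<open>a t\<close> lies to the right of \<open>\<alpha>s\<close>, hence starts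
  at or to the right of \<open>xbar M \<alpha>s\<close>. The quadratic term then beats the drift \<open>C * t\<close> and carries the
  characteristic beyond \<open>x\<close> for large \<open>t\<close>. The other side is symmetric.
\<close>

lemma characteristic_level_tendsto:
  assumes M: "finite_borel_measure M" and bound: "\<And>z. \<bar>u0 z\<bar> \<le> C"
    and star: "\<alpha>s - xbar M \<alpha>s = measure M UNIV / 2"
    and through: "\<And>t. flow u0 M (a t) t = x"
  shows "((\<lambda>t. a t - xbar M (a t)) \<longlongrightarrow> measure M UNIV / 2) at_top"
proof (rule tendstoI)
  interpret finite_borel_measure M by (rule M)
  fix e :: real assume "e > 0"
  define D where "D = \<bar>x - xbar M \<alpha>s\<bar>"
  have "C \<ge> 0" using bound[of 0] by linarith
  have "\<forall>\<^sub>F t in at_top. t \<ge> 1 \<and> t > 4 * (D + C) / e"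
    by (intro eventually_conj eventually_ge_at_top eventually_gt_at_top)
  then show "\<forall>\<^sub>F t in at_top. dist (a t - xbar M (a t)) (measure M UNIV / 2) < e"
  proof eventually_elim
    case (elim t)
    define k where "k = a t - xbar M (a t) - measure M UNIV / 2"
    have "D + C * t \<le> (D + C) * t"
      using elim mult_left_mono[of 1 t D] by (simp add: D_def distrib_right)
    also have "\<dots> < (e * t / 4) * t"
      using elim \<open>e > 0\<close> by (intro mult_strict_right_mono) (auto simp: field_simps)
    finally have big: "D + C * t < t\<^sup>2 / 4 * e" by (simp add: power2_eq_square mult_ac)
    have x: "x = xbar M (a t) + u0 (xbar M (a t)) * t + t\<^sup>2 / 4 * k"
      using through[of t] by (simp add: flow_def k_def)
    have "\<bar>u0 (xbar M (a t)) * t\<bar> \<le> C * t"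
      using elim bound by (simp add: abs_mult mult_right_mono)
    then have u: "- (C * t) \<le> u0 (xbar M (a t)) * t" "u0 (xbar M (a t)) * t \<le> C * t"
      by linarith+
    have "k < e"
    proof (rule ccontr)
      assume "\<not> k < e"
      then have "t\<^sup>2 / 4 * e \<le> t\<^sup>2 / 4 * k" by (intro mult_left_mono) auto
      moreover have "\<alpha>s \<le> a t"
        using xbar_defect_mono[of "a t" \<alpha>s] star \<open>\<not> k < e\<close> \<open>e > 0\<close> unfolding k_def by linarith
      then have "xbar M \<alpha>s \<le> xbar M (a t)" by (rule xbar_mono)
      ultimately show False using x u big unfolding D_def by linarith
    qed
    moreover have "- e < k"
    proof (rule ccontr)
      assume "\<not> - e < k"
      then have "t\<^sup>2 / 4 * k \<le> t\<^sup>2 / 4 * - e" by (intro mult_left_mono) auto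
      moreover have "a t \<le> \<alpha>s"
        using xbar_defect_mono[of \<alpha>s "a t"] star \<open>\<not> - e < k\<close> \<open>e > 0\<close> unfolding k_def by linarith
      then have "xbar M (a t) \<le> xbar M \<alpha>s" by (rule xbar_mono)
      ultimately show False using x u big unfolding D_def by linarith
    qed
    ultimately show ?case by (simp add: k_def dist_real_def abs_less_iff)
  qed
qed

text \<open>
  Eliminating the level from the equation of the characteristic reverses the sign of \<open>u0\<close>: the
  acceleration that brings the characteristic back to \<open>x\<close> by time \<open>t\<close> changes its velocity by about
  twice its initial velocity.
\<close>

lemma velocity_along_characteristic:
  assumes "t \<noteq> 0" "flow u0 M \<alpha> t = x"
  shows "u0 (xbar M \<alpha>) + t / 2 * (\<alpha> - xbar M \<alpha> - measure M UNIV / 2)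
           = 2 * (x - xbar M \<alpha>) / t - u0 (xbar M \<alpha>)"
proof -
  have "x - xbar M \<alpha> = t * (u0 (xbar M \<alpha>) + t / 4 * (\<alpha> - xbar M \<alpha> - measure M UNIV / 2))"
    using assms(2) by (simp add: flow_def power2_eq_square algebra_simps)
  then have "(x - xbar M \<alpha>) / t = u0 (xbar M \<alpha>) + t / 4 * (\<alpha> - xbar M \<alpha> - measure M UNIV / 2)"
    using assms(1) by simp
  then show ?thesis by (simp add: field_simps)
qed

section \<open>The limit of the velocity\<close>

theorem theorem1p9:
  fixes u0 :: "real \<Rightarrow> real" and \<mu>0 :: "real measure"
    and u :: "real \<Rightarrow> real \<Rightarrow> real" and \<mu> :: "real \<Rightarrow> real measure"
    and \<alpha>s x :: real
  assumes data: "(u0, \<mu>0) \<in> space_D"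
    and nondegenerate: "measure \<mu>0 UNIV \<noteq> 0 \<or> (\<forall>z. u0 z = 0)"
    and sol: "conservative_solution u0 \<mu>0 u \<mu>"
    and star: "\<alpha>s - xbar \<mu>0 \<alpha>s = measure \<mu>0 UNIV / 2"
  shows "((\<lambda>t. u x t) \<longlongrightarrow> - u0 (xbar \<mu>0 \<alpha>s)) at_top"
proof -
  have M: "finite_borel_measure \<mu>0"
    using data by (auto simp: space_D_def finite_borel_measure_def finite_borel_measure_axioms_def)
  interpret finite_borel_measure \<mu>0 by (rule M)
  have cont: "continuous_on UNIV u0" and "bounded (range u0)"
    using data by (auto simp: space_D_def bcontfun_def)
  then obtain C where bound: "\<bar>u0 z\<bar> \<le> C" for z
    by (auto simp: bounded_iff)
  have "\<forall>t. \<exists>\<alpha>. flow u0 \<mu>0 \<alpha> t = x"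
    using flow_surj[OF M cont bound] by blast
  from choice[OF this] obtain a where through: "flow u0 \<mu>0 (a t) t = x" for t
    by blast
  have u: "u x t = u0 (xbar \<mu>0 (a t))
      + t / 2 * (a t - xbar \<mu>0 (a t) - measure \<mu>0 UNIV / 2)" for t
    using sol through unfolding conservative_solution_def by metis
  show ?thesis
  proof (cases "measure \<mu>0 UNIV = 0")
    case True
    then have "u0 z = 0" for z using nondegenerate by blast
    moreover have "a t - xbar \<mu>0 (a t) = 0" for t
      using xbar_defect_bounds[of "a t"] True by linarith
    ultimately show ?thesis by (simp add: u True)
  next
    case False
    then have "0 < measure \<mu>0 UNIV / 2" "measure \<mu>0 UNIV / 2 < measure \<mu>0 UNIV"
      using measure_nonneg[of \<mu>0 UNIV] by linarith+
    then obtain A B where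
      AB: "A - xbar \<mu>0 A < measure \<mu>0 UNIV / 2" "measure \<mu>0 UNIV / 2 < B - xbar \<mu>0 B"
      by (rule xbar_defect_attains_around)
    have level: "u0 (xbar \<mu>0 \<alpha>) = u0 (xbar \<mu>0 \<alpha>s)"
      if "\<alpha> - xbar \<mu>0 \<alpha> = measure \<mu>0 UNIV / 2" for \<alpha>
    proof (cases "xbar \<mu>0 \<alpha>" "xbar \<mu>0 \<alpha>s" rule: linorder_cases)
      case less
      then show ?thesis using that star by (intro velocity_const_on_level[OF data]) simp
    next
      case greater
      then show ?thesis using that star by (intro velocity_const_on_level[OF data, symmetric]) simp
    qed simp
    have h_cont: "continuous_on UNIV (\<lambda>\<alpha>. \<alpha> - xbar \<mu>0 \<alpha>)"
      by (intro continuous_intros xbar_continuous)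
    have g_cont: "continuous_on UNIV (\<lambda>\<alpha>. u0 (xbar \<mu>0 \<alpha>))"
      by (rule continuous_on_compose2[OF cont xbar_continuous]) simp
    have h_mono: "mono (\<lambda>\<alpha>. \<alpha> - xbar \<mu>0 \<alpha>)"
      by (intro monoI xbar_defect_mono)
    note lim = mono_level_tendsto_value[where h = "\<lambda>\<alpha>. \<alpha> - xbar \<mu>0 \<alpha>"
        and g = "\<lambda>\<alpha>. u0 (xbar \<mu>0 \<alpha>)" and k = "u0 (xbar \<mu>0 \<alpha>s)",
        OF h_cont g_cont h_mono AB _ characteristic_level_tendsto[OF M bound star through]]
    have inside: "\<forall>\<^sub>F t in at_top. a t \<in> {A..B}"
      by (rule lim(1)) (rule level)
    have value_lim: "((\<lambda>t. u0 (xbar \<mu>0 (a t))) \<longlongrightarrow> u0 (xbar \<mu>0 \<alpha>s)) at_top"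
      by (rule lim(2)) (rule level)
    define D where "D = 2 * (\<bar>x - xbar \<mu>0 A\<bar> + \<bar>x - xbar \<mu>0 B\<bar>)"
    have drift: "((\<lambda>t. 2 * (x - xbar \<mu>0 (a t)) / t) \<longlongrightarrow> 0) at_top"
    proof (rule Lim_null_comparison)
      show "((\<lambda>t. D / t) \<longlongrightarrow> 0) at_top"
        by (intro tendsto_divide_0[OF tendsto_const] filterlim_at_top_imp_at_infinity filterlim_ident)
      show "\<forall>\<^sub>F t in at_top. norm (2 * (x - xbar \<mu>0 (a t)) / t) \<le> D / t"
        using inside eventually_gt_at_top[of 0]
      proof eventually_elim
        case (elim t)
        then have "xbar \<mu>0 A \<le> xbar \<mu>0 (a t)" "xbar \<mu>0 (a t) \<le> xbar \<mu>0 B"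
          by (auto intro: xbar_mono)
        then have "\<bar>x - xbar \<mu>0 (a t)\<bar> \<le> \<bar>x - xbar \<mu>0 A\<bar> + \<bar>x - xbar \<mu>0 B\<bar>"
          by linarith
        then have "\<bar>2 * (x - xbar \<mu>0 (a t))\<bar> \<le> D"
          unfolding D_def abs_mult by simp
        then have "\<bar>2 * (x - xbar \<mu>0 (a t))\<bar> / t \<le> D / t"
          using elim by (intro divide_right_mono) auto
        then show ?case using elim by (simp add: abs_divide)
      qed
    qed
    have "((\<lambda>t. 2 * (x - xbar \<mu>0 (a t)) / t - u0 (xbar \<mu>0 (a t))) \<longlongrightarrow> 0 - u0 (xbar \<mu>0 \<alpha>s)) at_top"
      by (intro tendsto_diff drift value_lim)
    moreover have "\<forall>\<^sub>F t in at_top. 2 * (x - xbar \<mu>0 (a t)) / t - u0 (xbar \<mu>0 (a t)) = u x t"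
      using eventually_gt_at_top[of 0]
      by eventually_elim (use velocity_along_characteristic[OF _ through] u in simp)
    ultimately show ?thesis
      using Lim_transform_eventually by fastforce
  qed
qed

end
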